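(* Let $t>0$, let $i_1<\dots<i_M$ be real, let $\underline p\in\mathbb S^M$, let $\underline b=(b_2,\dots,b_{M-1})$ satisfy $-\frac{1}{i_{j+1}-i_j}<b_j<\frac{1}{i_j-i_{j-1}}$ for $j=2,\dots,M-1$, and let $\underline k=(k_2,\dots,k_{M-1})\in\mathbb R_+^{M-2}$. There exist a unique $\alpha\in(0,1]$, $l\in\{2,\dots,M\}$, $x_0\in(\kappa_{l-1},\kappa_l]$ and $\underline\lambda=(\lambda_2,\dots,\lambda_{M-1})\in\mathbb R_+^{M-2}$ satisfying, for $j=1,\dots,M+1$, $$\big(\widehat{\underline p}\,\widetilde{\mathcal N}_t\big)_j=\begin{cases}\frac{x_0-\kappa_{l-1}}{\kappa_l-\kappa_{l-1}}&j=l\\[2pt]\frac{\kappa_l-x_0}{\kappa_l-\kappa_{l-1}}&j=l-1\\[2pt]0&\text{otherwise,}\end{cases}$$ where $\widehat{\underline p}$ is the row vector with $\widehat p_j=\alpha p_j$ for $j=1,\dots,M$ and $\widehat p_{M+1}=1-\alpha$. The solution is (with $\lambda_1=\lambda_M=0$) $$\lambda_j=\mathcal G_j(t,\underline p)\ (2\le j\le M-1),\qquad \alpha=\frac{1}{1+t\sum_{j=1}^Mp_j\lambda_j\widetilde k_j},\qquad x_0=\frac{\sum_{j=1}^M\kappa_jp_j(1+t\,\mathcal G_j(t,\underline p)\widetilde k_j)}{\sum_{j=1}^Mp_j(1+t\,\mathcal G_j(t,\underline p)\widetilde k_j)}.$$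
   Context: Conventions: $\mathbb R_+=[0,\infty)$, $M\ge3$, $\mathbb S^M=\{(p_1,\dots,p_M):0<p_j<1,\ \sum_jp_j=1\}$. Set $\widetilde k_j=(i_{j+1}-i_j)(i_j-i_{j-1})k_j$ for $2\le j\le M-1$, $\widetilde k_1=\widetilde k_M=0$; for $2\le j\le M-1$, $q_{j,j+1}=\frac{i_j-i_{j-1}}{i_{j+1}-i_{j-1}}(1+(i_{j+1}-i_j)b_j)$, $q_{j,j-1}=\frac{i_{j+1}-i_j}{i_{j+1}-i_{j-1}}(1-(i_j-i_{j-1})b_j)$. $\widetilde{\mathcal N}_t=\widetilde{\mathcal N}_t(\underline k,\underline\lambda)$ is the $(M+1)\times(M+1)$ matrix whose rows $1$, $M$, $M+1$ are those of the identity matrix and, for $2\le j\le M-1$, $\widetilde{\mathcal N}_{t;j,j}=1+t\lambda_j(1+\widetilde k_j)$, $\widetilde{\mathcal N}_{t;j,j+1}=-t\lambda_jq_{j,j+1}$, $\widetilde{\mathcal N}_{t;j,j-1}=-t\lambda_jq_{j,j-1}$ (neighbours in $\{1,\dots,M\}$), $\widetilde{\mathcal N}_{t;j,M+1}=-t\lambda_j\widetilde k_j$, all other entries $0$. Coordinate change $\underline\kappa=(\kappa_1,\dots,\kappa_M)$: let $\delta_j=i_j-i_{j-1}$ ($2\le j\le M$); $\Pi_1=1$, $\Pi_j=\prod_{n=2}^j\frac{1-\delta_nb_n}{1+\delta_{n+1}b_n}$ ($2\le j\le M-1$). Fix $\vartheta\in(0,\frac12)$ with $e_-:=\inf\{j:\sum_{i=1}^jp_i\ge\vartheta\}<e_+:=\sup\{j:\sum_{i=j}^Mp_i\ge\vartheta\}$,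 let $K=(i_{e_+}-i_{e_-})\vee1$, $\epsilon_{j+1}=K\,\delta_{j+1}\Pi_j\big/\sum_{a=e_-}^{e_+-1}\delta_{a+1}\Pi_a$ ($1\le j\le M-1$). Let $e$ satisfy $\sum_{i\le e}p_i\ge\frac12$, $\sum_{i\ge e}p_i\ge\frac12$. Then $\kappa_e=0$ and $\kappa_j-\kappa_{j-1}=\epsilon_j$ for $2\le j\le M$; $\underline\kappa$ is strictly increasing and $q_{j,j+1}=\frac{\kappa_j-\kappa_{j-1}}{\kappa_{j+1}-\kappa_{j-1}}$, $q_{j,j-1}=\frac{\kappa_{j+1}-\kappa_j}{\kappa_{j+1}-\kappa_{j-1}}$. $\mathcal G(t,\underline p)=(\mathcal G_1,\dots,\mathcal G_M)$ (nonnegative entries) is defined by the system: $\mathcal G_1=\mathcal G_M=0$, $$\mathcal G_j=\frac{1}{tp_j}\frac{\kappa_{j+1}-\kappa_{j-1}}{(\kappa_{j+1}-\kappa_j)(\kappa_j-\kappa_{j-1})}\times\begin{cases}\sum_{a=1}^{j-1}(\kappa_j-\kappa_a)p_a(1+t\mathcal G_a\widetilde k_a)&2\le j\le l-1\\ \sum_{a=j+1}^{M}(\kappa_a-\kappa_j)p_a(1+t\mathcal G_a\widetilde k_a)&l\le j\le M-1\end{cases}$$ where $l$ is the index with $\kappa_{l-1}<\frac{\sum_{j=1}^M\kappa_jp_j(1+t\mathcal G_j\widetilde k_j)}{\sum_{j=1}^Mp_j(1+t\mathcal G_j\widetilde k_j)}\le\kappa_l$. *)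

theory Defs
  imports Complex_Main
begin

text \<open>
  Finite families indexed by \<open>1, \<dots>, M\<close> (or \<open>2, \<dots>, M - 1\<close>) are functions on \<open>nat\<close> of which only
  the values at these indices are used; an \<open>(M + 1) \<times> (M + 1)\<close> matrix is a function of a row
  index and a column index in \<open>{1..M + 1}\<close>.
\<close>

definition open_simplex :: "nat \<Rightarrow> (nat \<Rightarrow> real) set" where
  "open_simplex M = {p. (\<forall>j\<in>{1..M}. 0 < p j \<and> p j < 1) \<and> (\<Sum>j=1..M. p j) = 1}"

definition ktilde :: "nat \<Rightarrow> (nat \<Rightarrow> real) \<Rightarrow> (nat \<Rightarrow> real) \<Rightarrow> nat \<Rightarrow> real" where
  "ktilde M i k j =
     (if j \<in> {2..M - 1} then (i (j + 1) - i j) * (i j - i (j - 1)) * k j else 0)"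

text \<open>\<open>q_up i b j\<close> is \<open>q\<^bsub>j,j+1\<^esub>\<close> and \<open>q_down i b j\<close> is \<open>q\<^bsub>j,j-1\<^esub>\<close>.\<close>

definition q_up :: "(nat \<Rightarrow> real) \<Rightarrow> (nat \<Rightarrow> real) \<Rightarrow> nat \<Rightarrow> real" where
  "q_up i b j = (i j - i (j - 1)) / (i (j + 1) - i (j - 1)) * (1 + (i (j + 1) - i j) * b j)"

definition q_down :: "(nat \<Rightarrow> real) \<Rightarrow> (nat \<Rightarrow> real) \<Rightarrow> nat \<Rightarrow> real" where
  "q_down i b j = (i (j + 1) - i j) / (i (j + 1) - i (j - 1)) * (1 - (i j - i (j - 1)) * b j)"

definition Ntilde ::
    "nat \<Rightarrow> (nat \<Rightarrow> real) \<Rightarrow> (nat \<Rightarrow> real) \<Rightarrow> real \<Rightarrow> (nat \<Rightarrow> real) \<Rightarrow> (nat \<Rightarrow> real) \<Rightarrow> nat \<Rightarrow> nat \<Rightarrow> real"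
  where
  "Ntilde M i b t k lam r c =
     (if r \<in> {2..M - 1} then
        (if c = r then 1 + t * lam r * (1 + ktilde M i k r)
         else if c = r + 1 then - t * lam r * q_up i b r
         else if c = r - 1 then - t * lam r * q_down i b r
         else if c = M + 1 then - t * lam r * ktilde M i k r
         else 0)
      else if c = r then 1 else 0)"

definition gap :: "(nat \<Rightarrow> real) \<Rightarrow> nat \<Rightarrow> real" where
  "gap i j = i j - i (j - 1)"

text \<open>The product is empty for \<open>j = 1\<close>, which gives \<open>\<Pi>\<^sub>1 = 1\<close>.\<close>

definition Pi_prod :: "(nat \<Rightarrow> real) \<Rightarrow> (nat \<Rightarrow> real) \<Rightarrow> nat \<Rightarrow> real" where
  "Pi_prod i b j = (\<Prod>n=2..j. (1 - gap i n * b n) / (1 + gap i (n + 1) * b n))"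

definition e_minus :: "nat \<Rightarrow> (nat \<Rightarrow> real) \<Rightarrow> real \<Rightarrow> nat" where
  "e_minus M p \<theta> = Inf {j \<in> {1..M}. (\<Sum>a=1..j. p a) \<ge> \<theta>}"

definition e_plus :: "nat \<Rightarrow> (nat \<Rightarrow> real) \<Rightarrow> real \<Rightarrow> nat" where
  "e_plus M p \<theta> = Sup {j \<in> {1..M}. (\<Sum>a=j..M. p a) \<ge> \<theta>}"

definition eps ::
    "nat \<Rightarrow> (nat \<Rightarrow> real) \<Rightarrow> (nat \<Rightarrow> real) \<Rightarrow> (nat \<Rightarrow> real) \<Rightarrow> real \<Rightarrow> nat \<Rightarrow> real" where
  "eps M i b p \<theta> j =
     max (i (e_plus M p \<theta>) - i (e_minus M p \<theta>)) 1 * (gap i j * Pi_prod i b (j - 1))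
       / (\<Sum>a=e_minus M p \<theta>..e_plus M p \<theta> - 1. gap i (a + 1) * Pi_prod i b a)"

text \<open>
  \<open>kappa\<close> is the solution of \<open>\<kappa>\<^sub>e = 0\<close>, \<open>\<kappa>\<^sub>j - \<kappa>\<^bsub>j-1\<^esub> = \<epsilon>\<^sub>j\<close>, as the two lemmas after
  the definition show; for each \<open>j\<close> at most one of the two sums is nonempty.
\<close>

definition kappa ::
    "nat \<Rightarrow> (nat \<Rightarrow> real) \<Rightarrow> (nat \<Rightarrow> real) \<Rightarrow> (nat \<Rightarrow> real) \<Rightarrow> real \<Rightarrow> nat \<Rightarrow> nat \<Rightarrow> real" where
  "kappa M i b p \<theta> e j = (\<Sum>n=e + 1..j. eps M i b p \<theta> n) - (\<Sum>n=j + 1..e. eps M i b p \<theta> n)"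

lemma kappa_base: "kappa M i b p \<theta> e e = 0"
  by (simp add: kappa_def)

lemma kappa_step:
  assumes "2 \<le> j"
  shows "kappa M i b p \<theta> e j - kappa M i b p \<theta> e (j - 1) = eps M i b p \<theta> j"
proof (cases "j \<le> e")
  case True
  then have "{j..e} = insert j {j + 1..e}" by auto
  then show ?thesis using assms True by (simp add: kappa_def)
next
  case False
  then have "{e + 1..j} = insert j {e + 1..j - 1}" using assms by auto
  then show ?thesis using assms False by (simp add: kappa_def)
qed

text \<open>In the following, \<open>\<kappa>\<close> and \<open>kt\<close> stand for the families \<open>\<kappa>\<^sub>j\<close> and \<open>ktilde\<close>.\<close>

definition weighted_mean ::
    "nat \<Rightarrow> (nat \<Rightarrow> real) \<Rightarrow> (nat \<Rightarrow> real) \<Rightarrow> real \<Rightarrow> (nat \<Rightarrow> real) \<Rightarrow> (nat \<Rightarrow> real) \<Rightarrow> real" where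
  "weighted_mean M \<kappa> kt t p G =
     (\<Sum>j=1..M. \<kappa> j * p j * (1 + t * G j * kt j)) / (\<Sum>j=1..M. p j * (1 + t * G j * kt j))"

text \<open>
  A family indexed by \<open>2, \<dots>, M - 1\<close> that is to be determined uniquely is set to \<open>0\<close> at all other
  indices; at \<open>1\<close> and \<open>M\<close> this is the convention \<open>\<lambda>\<^sub>1 = \<lambda>\<^sub>M = 0\<close>, respectively the equation
  \<open>G\<^sub>1 = G\<^sub>M = 0\<close>.
\<close>

definition nonneg_family :: "nat \<Rightarrow> (nat \<Rightarrow> real) set" where
  "nonneg_family M = {x. (\<forall>j\<in>{2..M - 1}. 0 \<le> x j) \<and> (\<forall>j. j \<notin> {2..M - 1} \<longrightarrow> x j = 0)}"

definition G_system ::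
    "nat \<Rightarrow> (nat \<Rightarrow> real) \<Rightarrow> (nat \<Rightarrow> real) \<Rightarrow> real \<Rightarrow> (nat \<Rightarrow> real) \<Rightarrow> (nat \<Rightarrow> real) \<Rightarrow> nat \<Rightarrow> bool" where
  "G_system M \<kappa> kt t p G l \<longleftrightarrow>
     G \<in> nonneg_family M \<and> l \<in> {2..M} \<and>
     \<kappa> (l - 1) < weighted_mean M \<kappa> kt t p G \<and> weighted_mean M \<kappa> kt t p G \<le> \<kappa> l \<and>
     (\<forall>j\<in>{2..M - 1}.
        G j = 1 / (t * p j) * ((\<kappa> (j + 1) - \<kappa> (j - 1)) / ((\<kappa> (j + 1) - \<kappa> j) * (\<kappa> j - \<kappa> (j - 1)))) *
          (if j \<le> l - 1 then \<Sum>a=1..j - 1. (\<kappa> j - \<kappa> a) * p a * (1 + t * G a * kt a)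
           else \<Sum>a=j + 1..M. (\<kappa> a - \<kappa> j) * p a * (1 + t * G a * kt a)))"

definition calG ::
    "nat \<Rightarrow> (nat \<Rightarrow> real) \<Rightarrow> (nat \<Rightarrow> real) \<Rightarrow> real \<Rightarrow> (nat \<Rightarrow> real) \<Rightarrow> nat \<Rightarrow> real" where
  "calG M \<kappa> kt t p = (THE G. \<exists>l. G_system M \<kappa> kt t p G l)"

definition p_hat :: "nat \<Rightarrow> real \<Rightarrow> (nat \<Rightarrow> real) \<Rightarrow> nat \<Rightarrow> real" where
  "p_hat M \<alpha> p j = (if j = M + 1 then 1 - \<alpha> else \<alpha> * p j)"

definition is_solution ::
    "nat \<Rightarrow> (nat \<Rightarrow> real) \<Rightarrow> (nat \<Rightarrow> real) \<Rightarrow> real \<Rightarrow> (nat \<Rightarrow> real) \<Rightarrow> (nat \<Rightarrow> real) \<Rightarrow> (nat \<Rightarrow> real) \<Rightarrow>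
      real \<Rightarrow> nat \<Rightarrow> real \<Rightarrow> (nat \<Rightarrow> real) \<Rightarrow> bool" where
  "is_solution M i b t k p \<kappa> \<alpha> l x0 lam \<longleftrightarrow>
     \<alpha> \<in> {0<..1} \<and> l \<in> {2..M} \<and> x0 \<in> {\<kappa> (l - 1)<..\<kappa> l} \<and> lam \<in> nonneg_family M \<and>
     (\<forall>j\<in>{1..M + 1}.
        (\<Sum>r=1..M + 1. p_hat M \<alpha> p r * Ntilde M i b t k lam r j) =
          (if j = l then (x0 - \<kappa> (l - 1)) / (\<kappa> l - \<kappa> (l - 1))
           else if j = l - 1 then (\<kappa> l - x0) / (\<kappa> l - \<kappa> (l - 1))
           else 0))"

end

theory Submission
  imports Defs
begin

text \<open>
  Write \<open>w\<^sub>j = p\<^sub>j (1 + t G\<^sub>j k\<^sub>j)\<close>. The \<open>G\<close>-equations left of \<open>l\<close> are a recursion from the left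
  for the put potential \<open>L\<^sub>j = \<Sum>\<^bsub>a<j\<^esub> (\<kappa>\<^sub>j - \<kappa>\<^sub>a) w\<^sub>a\<close>, those from \<open>l\<close> on a recursion from the right
  for the call potential \<open>R\<^sub>j = \<Sum>\<^bsub>a>j\<^esub> (\<kappa>\<^sub>a - \<kappa>\<^sub>j) w\<^sub>a\<close>; neither recursion involves \<open>l\<close>. The
  condition on the weighted mean says exactly \<open>L\<^bsub>l-1\<^esub> < R\<^bsub>l-1\<^esub>\<close> and \<open>R\<^sub>l \<le> L\<^sub>l\<close>, and since \<open>L - R\<close> is
  strictly increasing from a negative to a nonnegative value, it selects a unique \<open>l\<close>.

  The matrix equation is equivalent to this system: its first \<open>M\<close> columns are tested against the
  functions \<open>1\<close>, \<open>\<kappa>\<^sub>a\<close>, \<open>(\<kappa>\<^sub>j - \<kappa>\<^sub>a)\<^sup>+\<close> and \<open>(\<kappa>\<^sub>a - \<kappa>\<^sub>j)\<^sup>+\<close>. In the \<open>\<kappa>\<close>-coordinates \<open>q\<close> is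
  harmonic for affine functions, so a put or a call sees the off-diagonal part of the matrix only
  in row \<open>j\<close>. The affine tests and the last column give \<open>\<alpha>\<close> and \<open>x\<^sub>0\<close>, the puts and calls give the
  equations for \<open>\<lambda>\<close>, and together these test functions determine a vector.
\<close>

section \<open>Sums over initial and final segments, and a triangular system\<close>

lemma sum_put_eq:
  fixes f :: "nat \<Rightarrow> real"
  assumes "j \<le> M"
  shows "(\<Sum>a=1..j - 1. f a) = (\<Sum>a=1..M. if a < j then f a else 0)"
  using assms by (intro sum.mono_neutral_cong_left) auto

lemma sum_call_eq:
  fixes f :: "nat \<Rightarrow> real"
  shows "(\<Sum>a=j + 1..M. f a) = (\<Sum>a=1..M. if j < a then f a else 0)"
  by (intro sum.mono_neutral_cong_left) auto

lemma sign_of_scaled_diff: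
  fixes x y w d :: real
  assumes "0 < w" and "(x - y) * w = d"
  shows "y < x \<longleftrightarrow> 0 < d" and "x \<le> y \<longleftrightarrow> d \<le> 0"
  using assms by (auto simp: zero_less_mult_iff mult_le_0_iff)

lemma strict_mono_on_of_step:
  fixes f :: "nat \<Rightarrow> real"
  assumes "\<And>j. 2 \<le> j \<Longrightarrow> j \<le> M \<Longrightarrow> f (j - 1) < f j"
  shows "strict_mono_on {1..M} f"
proof (rule strict_mono_onI)
  fix r s assume rs: "r \<in> {1..M}" "s \<in> {1..M}" "r < s"
  have "Suc r \<le> s" using rs by simp
  then have "s \<le> M \<longrightarrow> f r < f s"
  proof (induction s rule: dec_induct)
    case base
    then show ?case using assms[of "Suc r"] rs by auto
  next
    case (step n)
    then show ?case using assms[of "Suc n"] rs by auto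
  qed
  then show "f r < f s" using rs by auto
qed

text \<open>The put with strike \<open>\<kappa> (Suc j)\<close> sees only \<open>v 1\<close>, ...,
  \<open>v j\<close>, with coefficient \<open>\<kappa> (Suc j) - \<kappa> j > 0\<close> on the last
  of them. Strong induction thus removes every entry except \<open>v M\<close>, which the total mass
  removes.\<close>

lemma family_eq_zero_of_puts:
  fixes \<kappa> v :: "nat \<Rightarrow> real"
  assumes \<kappa>: "strict_mono_on {1..M} \<kappa>"
    and puts: "\<And>j. 2 \<le> j \<Longrightarrow> j \<le> M \<Longrightarrow> (\<Sum>a=1..j - 1. (\<kappa> j - \<kappa> a) * v a) = 0"
    and total: "(\<Sum>a=1..M. v a) = 0"
    and "j \<in> {1..M}"
  shows "v j = 0"
proof -
  have init: "1 \<le> j \<Longrightarrow> j < M \<Longrightarrow> v j = 0" for j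
  proof (induction j rule: less_induct)
    case (less j)
    have "(\<Sum>a=1..j. (\<kappa> (Suc j) - \<kappa> a) * v a) = 0"
      using puts[of "Suc j"] less.prems by simp
    moreover have "{1..j} = insert j {1..j - 1}" using less.prems by auto
    moreover have "(\<Sum>a=1..j - 1. (\<kappa> (Suc j) - \<kappa> a) * v a) = 0"
      using less by (intro sum.neutral) auto
    ultimately have "(\<kappa> (Suc j) - \<kappa> j) * v j = 0"
      using less.prems by simp
    moreover have "\<kappa> j < \<kappa> (Suc j)"
      using \<kappa> less.prems by (auto simp: strict_mono_on_def)
    ultimately show ?case by simp
  qed
  have "(\<Sum>a=1..M. v a) = v M + (\<Sum>a=1..M - 1. v a)"
    using assms(4) by (cases M) auto
  moreover have "(\<Sum>a=1..M - 1. v a) = 0"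
    using init by (intro sum.neutral) auto
  ultimately have "v M = 0" using total by simp
  then show ?thesis using init assms(4) by (cases "j = M") auto
qed

section \<open>Put and call potentials as recursions\<close>

text \<open>Substituting \<open>G a = A a * L a\<close> into the weights turns the put equations
  into a recursion in the potential alone; \<open>c a\<close> will be
  \<open>t * A a * kt a\<close>.\<close>

function put_pot ::
    "(nat \<Rightarrow> real) \<Rightarrow> (nat \<Rightarrow> real) \<Rightarrow> (nat \<Rightarrow> real) \<Rightarrow> nat \<Rightarrow> real" where
  "put_pot \<kappa> p c j = (\<Sum>a=1..j - 1. (\<kappa> j - \<kappa> a) * (p a * (1 + c a * put_pot \<kappa> p c a)))"
  by auto
termination by (relation "measure (\<lambda>(\<kappa>, p, c, j). j)") auto

function call_pot ::
    "nat \<Rightarrow> (nat \<Rightarrow> real) \<Rightarrow> (nat \<Rightarrow> real) \<Rightarrow> (nat \<Rightarrow> real) \<Rightarrow> nat \<Rightarrow> real" where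
  "call_pot M \<kappa> p c j =
     (\<Sum>a=j + 1..M. (\<kappa> a - \<kappa> j) * (p a * (1 + c a * call_pot M \<kappa> p c a)))"
  by auto
termination by (relation "measure (\<lambda>(M, \<kappa>, p, c, j). M - j)") auto

declare put_pot.simps [simp del] call_pot.simps [simp del]

text \<open>The \<open>G\<close>-system refers to \<open>i\<close>, \<open>b\<close> and
  \<open>k\<close> only through \<open>\<kappa>\<close> and \<open>kt\<close>, so it is solved over
  these two families.\<close>

locale chain =
  fixes M :: nat and t :: real and p \<kappa> kt :: "nat \<Rightarrow> real"
  assumes M: "3 \<le> M" and t: "0 < t"
    and p_pos: "\<And>j. j \<in> {1..M} \<Longrightarrow> 0 < p j"
    and p_sum: "(\<Sum>j=1..M. p j) = 1"
    and \<kappa>: "strict_mono_on {1..M} \<kappa>"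
    and kt_nonneg: "\<And>j. 0 \<le> kt j"
    and kt_out: "\<And>j. j \<notin> {2..M - 1} \<Longrightarrow> kt j = 0"
begin

lemma \<kappa>_less: "1 \<le> a \<Longrightarrow> a < b \<Longrightarrow> b \<le> M \<Longrightarrow> \<kappa> a < \<kappa> b"
  using \<kappa> by (auto simp: strict_mono_on_def)

text \<open>The prefactor of the \<open>G\<close>-equation. The value 0 outside
  \<open>{2..M - 1}\<close> encodes \<open>G 1 = G M = 0\<close>, so that \<open>G j\<close> is
  \<open>A j\<close> times a potential at every index.\<close>

definition A :: "nat \<Rightarrow> real" where
  "A j = (if j \<in> {2..M - 1}
     then 1 / (t * p j) * ((\<kappa> (j + 1) - \<kappa> (j - 1)) / ((\<kappa> (j + 1) - \<kappa> j) * (\<kappa> j - \<kappa> (j - 1))))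
     else 0)"

definition L :: "nat \<Rightarrow> real" where
  "L = put_pot \<kappa> p (\<lambda>a. t * A a * kt a)"

definition R :: "nat \<Rightarrow> real" where
  "R = call_pot M \<kappa> p (\<lambda>a. t * A a * kt a)"

lemma A_nonneg: "0 \<le> A j"
proof (cases "j \<in> {2..M - 1}")
  case True
  then have "0 < p j" "\<kappa> (j - 1) < \<kappa> j" "\<kappa> j < \<kappa> (j + 1)"
    by (auto intro!: p_pos \<kappa>_less)
  then show ?thesis using t by (simp add: A_def)
qed (auto simp: A_def)

lemma L_eq: "L j = (\<Sum>a=1..j - 1. (\<kappa> j - \<kappa> a) * (p a * (1 + t * A a * kt a * L a)))"
  unfolding L_def by (subst put_pot.simps) simp

lemma R_eq: "R j = (\<Sum>a=j + 1..M. (\<kappa> a - \<kappa> j) * (p a * (1 + t * A a * kt a * R a)))"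
  unfolding R_def by (subst call_pot.simps) simp

lemma coeff_nonneg: "0 \<le> t * A a * kt a"
  using t A_nonneg kt_nonneg by simp

lemma L_nonneg: "1 \<le> j \<Longrightarrow> j \<le> M \<Longrightarrow> 0 \<le> L j"
proof (induction j rule: less_induct)
  case (less j)
  have "0 \<le> (\<kappa> j - \<kappa> a) * (p a * (1 + t * A a * kt a * L a))" if "a \<in> {1..j - 1}" for a
  proof -
    have "0 \<le> L a" "\<kappa> a < \<kappa> j" "0 < p a"
      using less that by (auto intro!: \<kappa>_less p_pos less.IH)
    then show ?thesis using coeff_nonneg[of a] by simp
  qed
  then show ?case by (subst L_eq) (rule sum_nonneg)
qed

lemma R_nonneg: "1 \<le> j \<Longrightarrow> j \<le> M \<Longrightarrow> 0 \<le> R j"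
proof (induction "M - j" arbitrary: j rule: less_induct)
  case less
  have "0 \<le> (\<kappa> a - \<kappa> j) * (p a * (1 + t * A a * kt a * R a))" if "a \<in> {j + 1..M}" for a
  proof -
    have "0 \<le> R a" "\<kappa> j < \<kappa> a" "0 < p a"
      using less that by (auto intro!: \<kappa>_less p_pos less.hyps)
    then show ?thesis using coeff_nonneg[of a] by simp
  qed
  then show ?case by (subst R_eq) (rule sum_nonneg)
qed

lemma put_weight_pos: "a \<in> {1..M} \<Longrightarrow> 0 < p a * (1 + t * A a * kt a * L a)"
  using p_pos[of a] coeff_nonneg[of a] L_nonneg[of a] by (simp add: add_pos_nonneg)

lemma call_weight_pos: "a \<in> {1..M} \<Longrightarrow> 0 < p a * (1 + t * A a * kt a * R a)"
  using p_pos[of a] coeff_nonneg[of a] R_nonneg[of a] by (simp add: add_pos_nonneg)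

text \<open>Raising the strike from \<open>\<kappa> (j - 1)\<close> to \<open>\<kappa> j\<close>
  strictly increases every payoff on \<open>{1..j - 1}\<close>, including the one at
  \<open>j - 1\<close>, which starts from 0; the weights are positive.\<close>

lemma L_step:
  assumes "2 \<le> j" "j \<le> M"
  shows "L (j - 1) < L j"
proof -
  let ?w = "\<lambda>a. p a * (1 + t * A a * kt a * L a)"
  have w: "0 < ?w a" if "a \<in> {1..j - 1}" for a
    using that assms by (intro put_weight_pos) auto
  have "L (j - 1) = (\<Sum>a=1..j - 1. if a < j - 1 then (\<kappa> (j - 1) - \<kappa> a) * ?w a else 0)"
    by (subst L_eq) (rule sum_put_eq, simp)
  also have "\<dots> < (\<Sum>a=1..j - 1. (\<kappa> j - \<kappa> a) * ?w a)"
  proof (rule sum_strict_mono)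
    fix a assume a: "a \<in> {1..j - 1}"
    have "\<kappa> a < \<kappa> j" "\<kappa> (j - 1) < \<kappa> j" using a assms by (auto intro!: \<kappa>_less)
    then show "(if a < j - 1 then (\<kappa> (j - 1) - \<kappa> a) * ?w a else 0) < (\<kappa> j - \<kappa> a) * ?w a"
      using w[OF a] by (auto intro!: mult_strict_right_mono)
  qed (use assms in auto)
  also have "\<dots> = L j" by (subst (2) L_eq) simp
  finally show ?thesis .
qed

lemma R_step:
  assumes "2 \<le> j" "j \<le> M"
  shows "R j < R (j - 1)"
proof -
  let ?w = "\<lambda>a. p a * (1 + t * A a * kt a * R a)"
  have w: "0 < ?w a" if "a \<in> {j..M}" for a
    using that assms by (intro call_weight_pos) auto
  have "R j = (\<Sum>a=j..M. if j < a then (\<kappa> a - \<kappa> j) * ?w a else 0)"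
    by (subst R_eq) (intro sum.mono_neutral_cong_left, auto)
  also have "\<dots> < (\<Sum>a=j..M. (\<kappa> a - \<kappa> (j - 1)) * ?w a)"
  proof (rule sum_strict_mono)
    fix a assume a: "a \<in> {j..M}"
    have "\<kappa> (j - 1) < \<kappa> a" "\<kappa> (j - 1) < \<kappa> j" using a assms by (auto intro!: \<kappa>_less)
    then show "(if j < a then (\<kappa> a - \<kappa> j) * ?w a else 0) < (\<kappa> a - \<kappa> (j - 1)) * ?w a"
      using w[OF a] by (auto intro!: mult_strict_right_mono)
  qed (use assms in auto)
  also have "\<dots> = R (j - 1)" using assms by (subst (2) R_eq) simp
  finally show ?thesis .
qed

lemma L_first: "L 1 = 0" by (subst L_eq) simp

lemma R_last: "R M = 0" by (subst R_eq) simp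

text \<open>\<open>L - R\<close> increases strictly, from \<open>- R 1 < 0\<close> to
  \<open>L M \<ge> 0\<close>, hence changes sign exactly once.\<close>

lemma crossing_unique: "\<exists>!l. l \<in> {2..M} \<and> L (l - 1) < R (l - 1) \<and> R l \<le> L l"
proof -
  let ?D = "\<lambda>j. L j - R j"
  have D: "strict_mono_on {1..M} ?D"
    using L_step R_step by (intro strict_mono_on_of_step) (smt (verit))
  have D1: "?D 1 < 0"
    using L_first R_step[of 2] R_nonneg[of 2] M by simp
  have DM: "0 \<le> ?D M"
    using R_last L_nonneg[of M] M by simp
  \<comment> \<open>The bound \<open>1 \<le> j\<close> keeps the index 0, which lies outside the
    family, out of the search.\<close>
  define l where "l = (LEAST j. 1 \<le> j \<and> 0 \<le> ?D j)"
  have l: "1 \<le> l" "0 \<le> ?D l"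
    using LeastI[of "\<lambda>j. 1 \<le> j \<and> 0 \<le> ?D j" M] DM M unfolding l_def by auto
  have l_le: "l \<le> M"
    unfolding l_def by (rule Least_le) (use DM M in auto)
  have "l \<noteq> 1" using l D1 by auto
  then have l2: "2 \<le> l" using l by simp
  have "\<not> (1 \<le> l - 1 \<and> 0 \<le> ?D (l - 1))"
    by (rule not_less_Least) (use l2 in \<open>unfold l_def[symmetric], simp\<close>)
  then have prev: "?D (l - 1) < 0" using l2 by auto
  show ?thesis
  proof (rule ex1I[of _ l])
    show "l \<in> {2..M} \<and> L (l - 1) < R (l - 1) \<and> R l \<le> L l"
      using l2 l_le prev l by auto
  next
    fix m assume m: "m \<in> {2..M} \<and> L (m - 1) < R (m - 1) \<and> R m \<le> L m"
    have "\<not> m < l"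
    proof
      assume "m < l"
      then have "?D m \<le> ?D (l - 1)"
        using strict_mono_on_leD[OF D, of m "l - 1"] m l_le by auto
      then show False using m prev by auto
    qed
    moreover have "\<not> l < m"
    proof
      assume "l < m"
      then have "?D l \<le> ?D (m - 1)"
        using strict_mono_on_leD[OF D, of l "m - 1"] m l2 by auto
      then show False using m l by auto
    qed
    ultimately show "m = l" by simp
  qed
qed

section \<open>Existence and uniqueness for the \<open>G\<close>-system\<close>

definition G_of :: "nat \<Rightarrow> nat \<Rightarrow> real" where
  "G_of l j = A j * (if j \<le> l - 1 then L j else R j)"

text \<open>Although \<open>G_of l\<close> switches to the call branch at \<open>l\<close>, the put
  identity still reaches \<open>j = l\<close>, since its sum stops at \<open>l - 1\<close>. Likewise
  the call identity below reaches down to \<open>l - 1\<close>, so both hold at the two indices that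
  bound the mean.\<close>

lemma G_of_put:
  assumes "j \<le> l"
  shows "(\<Sum>a=1..j - 1. (\<kappa> j - \<kappa> a) * p a * (1 + t * G_of l a * kt a)) = L j"
  by (subst L_eq, rule sum.cong) (use assms in \<open>auto simp: G_of_def mult_ac\<close>)

lemma G_of_call:
  assumes "l - 1 \<le> j"
  shows "(\<Sum>a=j + 1..M. (\<kappa> a - \<kappa> j) * p a * (1 + t * G_of l a * kt a)) = R j"
  by (subst R_eq, rule sum.cong) (use assms in \<open>auto simp: G_of_def mult_ac\<close>)

text \<open>Put-call parity: \<open>\<kappa> a - \<kappa> j\<close> is its positive part minus its
  negative part.\<close>

lemma sum_centered_split:
  fixes w :: "nat \<Rightarrow> real"
  assumes "j \<in> {1..M}"
  shows "(\<Sum>a=1..M. (\<kappa> a - \<kappa> j) * w a) =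
    (\<Sum>a=j + 1..M. (\<kappa> a - \<kappa> j) * w a) - (\<Sum>a=1..j - 1. (\<kappa> j - \<kappa> a) * w a)"
proof -
  have "(\<Sum>a=j + 1..M. (\<kappa> a - \<kappa> j) * w a) - (\<Sum>a=1..j - 1. (\<kappa> j - \<kappa> a) * w a) =
    (\<Sum>a=1..M. (if j < a then (\<kappa> a - \<kappa> j) * w a else 0) -
      (if a < j then (\<kappa> j - \<kappa> a) * w a else 0))"
    using assms sum_put_eq[of j M "\<lambda>a. (\<kappa> j - \<kappa> a) * w a"]
      sum_call_eq[of "\<lambda>a. (\<kappa> a - \<kappa> j) * w a" j M]
    by (simp add: sum_subtractf)
  also have "\<dots> = (\<Sum>a=1..M. (\<kappa> a - \<kappa> j) * w a)"
    by (rule sum.cong) (auto simp: algebra_simps)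
  finally show ?thesis by simp
qed

lemma weight_sum_pos:
  assumes "\<And>j. 0 \<le> G j"
  shows "0 < (\<Sum>j=1..M. p j * (1 + t * G j * kt j))"
proof (rule sum_pos)
  fix j assume "j \<in> {1..M}"
  then show "0 < p j * (1 + t * G j * kt j)"
    using p_pos t kt_nonneg[of j] assms[of j] by (simp add: add_pos_nonneg)
qed (use M in auto)

text \<open>Clears the denominator, so that comparing the mean with \<open>x\<close> becomes a
  question about the sign of a centered moment.\<close>

lemma weighted_mean_minus:
  assumes "\<And>j. 0 \<le> G j"
  shows "(weighted_mean M \<kappa> kt t p G - x) * (\<Sum>j=1..M. p j * (1 + t * G j * kt j)) =
    (\<Sum>a=1..M. (\<kappa> a - x) * (p a * (1 + t * G a * kt a)))"
proof -
  let ?W = "\<Sum>j=1..M. p j * (1 + t * G j * kt j)"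
  have "weighted_mean M \<kappa> kt t p G * ?W = (\<Sum>a=1..M. \<kappa> a * p a * (1 + t * G a * kt a))"
    using weight_sum_pos[of G, OF assms] by (simp add: weighted_mean_def)
  then show ?thesis
    by (simp add: left_diff_distrib sum_subtractf sum_distrib_left mult.assoc)
qed

lemma G_of_nonneg:
  assumes "l \<in> {2..M}"
  shows "0 \<le> G_of l j"
proof (cases "j \<in> {2..M - 1}")
  case True
  then show ?thesis
    using A_nonneg[of j] L_nonneg[of j] R_nonneg[of j] by (auto simp: G_of_def)
qed (auto simp: G_of_def A_def)

lemma G_of_moment:
  assumes l: "l \<in> {2..M}" and j: "j \<in> {1..M}" "l - 1 \<le> j" "j \<le> l"
  shows "(weighted_mean M \<kappa> kt t p (G_of l) - \<kappa> j) * (\<Sum>a=1..M. p a * (1 + t * G_of l a * kt a))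
    = R j - L j"
  using weighted_mean_minus[of "G_of l" "\<kappa> j", OF G_of_nonneg[OF l]]
    sum_centered_split[OF j(1)] G_of_put[OF j(3)] G_of_call[OF j(2)]
  by (simp add: mult.assoc)

lemma G_of_mean_iff:
  assumes l: "l \<in> {2..M}"
  shows "\<kappa> (l - 1) < weighted_mean M \<kappa> kt t p (G_of l) \<longleftrightarrow> L (l - 1) < R (l - 1)"
    and "weighted_mean M \<kappa> kt t p (G_of l) \<le> \<kappa> l \<longleftrightarrow> R l \<le> L l"
proof -
  let ?W = "\<Sum>a=1..M. p a * (1 + t * G_of l a * kt a)"
  let ?m = "weighted_mean M \<kappa> kt t p (G_of l)"
  have W: "0 < ?W" by (rule weight_sum_pos[OF G_of_nonneg[OF l]])
  have "(?m - \<kappa> (l - 1)) * ?W = R (l - 1) - L (l - 1)"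
    by (rule G_of_moment[OF l]) (use l in auto)
  from sign_of_scaled_diff(1)[OF W this]
  show "\<kappa> (l - 1) < ?m \<longleftrightarrow> L (l - 1) < R (l - 1)" by simp
  have "(?m - \<kappa> l) * ?W = R l - L l"
    by (rule G_of_moment[OF l]) (use l in auto)
  from sign_of_scaled_diff(2)[OF W this]
  show "?m \<le> \<kappa> l \<longleftrightarrow> R l \<le> L l" by simp
qed

text \<open>Once \<open>l\<close> is fixed, the equations are triangular on each side: left of
  \<open>l\<close> a value depends on smaller indices, from \<open>l\<close> on it depends on larger
  ones. Two strong inductions identify the potentials of \<open>G\<close> with \<open>L\<close> and
  \<open>R\<close>.\<close>

lemma G_system_imp_G_of:
  assumes G: "G_system M \<kappa> kt t p G l"
  shows "G = G_of l"
proof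
  fix j
  let ?put = "\<lambda>j. \<Sum>a=1..j - 1. (\<kappa> j - \<kappa> a) * p a * (1 + t * G a * kt a)"
  let ?call = "\<lambda>j. \<Sum>a=j + 1..M. (\<kappa> a - \<kappa> j) * p a * (1 + t * G a * kt a)"
  have l: "l \<in> {2..M}" and out: "G j = 0" if "j \<notin> {2..M - 1}" for j
    using G that by (auto simp: G_system_def nonneg_family_def)
  have G_eq: "G j = A j * (if j \<le> l - 1 then ?put j else ?call j)" for j
    using G out[of j] by (auto simp: G_system_def A_def)
  have put: "?put j = L j" if "j \<le> l" for j
    using that
  proof (induction j rule: less_induct)
    case (less j)
    have "G a = A a * L a" if "a \<in> {1..j - 1}" for a
    proof -
      have "a < j" "a \<le> l" "a \<le> l - 1" using that less.prems by auto
      then show ?thesis using less.IH[of a] G_eq[of a] by simp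
    qed
    then show ?case by (subst L_eq, intro sum.cong) (auto simp: mult_ac)
  qed
  have call: "?call j = R j" if "l - 1 \<le> j" for j
    using that
  proof (induction "M - j" arbitrary: j rule: less_induct)
    case less
    have "G a = A a * R a" if "a \<in> {j + 1..M}" for a
    proof -
      have "M - a < M - j" "l - 1 \<le> a" "\<not> a \<le> l - 1" using that less.prems by auto
      then show ?thesis using less.hyps[of a] G_eq[of a] by simp
    qed
    then show ?case by (subst R_eq, intro sum.cong) (auto simp: mult_ac)
  qed
  show "G j = G_of l j"
    by (subst G_eq) (use put[of j] call[of j] in \<open>auto simp: G_of_def\<close>)
qed

lemma G_system_G_of_iff:
  "G_system M \<kappa> kt t p (G_of l) l \<longleftrightarrow> l \<in> {2..M} \<and> L (l - 1) < R (l - 1) \<and> R l \<le> L l"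
proof (cases "l \<in> {2..M}")
  case True
  have "G_of l \<in> nonneg_family M"
  proof -
    have "G_of l j = 0" if "j \<notin> {2..M - 1}" for j
      using that by (auto simp: G_of_def A_def)
    then show ?thesis using G_of_nonneg[OF True] by (auto simp: nonneg_family_def)
  qed
  moreover have "G_of l j = 1 / (t * p j) *
      ((\<kappa> (j + 1) - \<kappa> (j - 1)) / ((\<kappa> (j + 1) - \<kappa> j) * (\<kappa> j - \<kappa> (j - 1)))) *
      (if j \<le> l - 1 then \<Sum>a=1..j - 1. (\<kappa> j - \<kappa> a) * p a * (1 + t * G_of l a * kt a)
       else \<Sum>a=j + 1..M. (\<kappa> a - \<kappa> j) * p a * (1 + t * G_of l a * kt a))"
    if "j \<in> {2..M - 1}" for j
  proof (cases "j \<le> l - 1")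
    case True
    then show ?thesis using that by (subst G_of_put) (auto simp: G_of_def A_def)
  next
    case False
    then show ?thesis using that by (subst G_of_call) (auto simp: G_of_def A_def)
  qed
  ultimately show ?thesis
    using True G_of_mean_iff[OF True] unfolding G_system_def by blast
qed (auto simp: G_system_def)

lemma G_system_unique:
  obtains G l where "G_system M \<kappa> kt t p G l"
    and "\<And>G' l'. G_system M \<kappa> kt t p G' l' \<Longrightarrow> G' = G \<and> l' = l"
proof -
  obtain l where l: "l \<in> {2..M} \<and> L (l - 1) < R (l - 1) \<and> R l \<le> L l"
    and uniq: "\<And>m. m \<in> {2..M} \<and> L (m - 1) < R (m - 1) \<and> R m \<le> L m \<Longrightarrow> m = l"
    using crossing_unique by (elim ex1E) blast
  show ?thesis
  proof (rule that[of "G_of l" l])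
    show "G_system M \<kappa> kt t p (G_of l) l"
      using l G_system_G_of_iff by simp
  next
    fix G m assume G: "G_system M \<kappa> kt t p G m"
    then have "G = G_of m" by (rule G_system_imp_G_of)
    moreover have "m = l" using G calculation G_system_G_of_iff uniq by simp
    ultimately show "G = G_of l \<and> m = l" by simp
  qed
qed

end

section \<open>The matrix equation and its test functions\<close>

text \<open>The formulas for \<open>q\<close> in the \<open>\<kappa>\<close>-coordinates are
  assumptions here; the theorem derives them from the definition of \<open>eps\<close> before
  interpreting the locale.\<close>

locale tridiagonal_chain = chain +
  fixes i b k :: "nat \<Rightarrow> real"
  assumes kt_eq: "kt = ktilde M i k"
    and q_up: "\<And>j. j \<in> {2..M - 1} \<Longrightarrow>
      q_up i b j = (\<kappa> j - \<kappa> (j - 1)) / (\<kappa> (j + 1) - \<kappa> (j - 1))"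
    and q_down: "\<And>j. j \<in> {2..M - 1} \<Longrightarrow>
      q_down i b j = (\<kappa> (j + 1) - \<kappa> j) / (\<kappa> (j + 1) - \<kappa> (j - 1))"
begin

definition col :: "real \<Rightarrow> (nat \<Rightarrow> real) \<Rightarrow> nat \<Rightarrow> real" where
  "col \<alpha> lam c = (\<Sum>r=1..M + 1. p_hat M \<alpha> p r * Ntilde M i b t k lam r c)"

definition target :: "nat \<Rightarrow> real \<Rightarrow> nat \<Rightarrow> real" where
  "target l x j = (if j = l then (x - \<kappa> (l - 1)) / (\<kappa> l - \<kappa> (l - 1))
           else if j = l - 1 then (\<kappa> l - x) / (\<kappa> l - \<kappa> (l - 1))
           else 0)"

text \<open>The row acts as the weight \<open>1 + t * lam r * kt r\<close> plus a second-difference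
  operator. Rows 1 and \<open>M\<close> of the identity fit the same formula because
  \<open>lam r = 0\<close> there, whatever \<open>\<phi>\<close> is at 0 and
  \<open>M + 1\<close>.\<close>

lemma Ntilde_row:
  fixes \<phi> :: "nat \<Rightarrow> real"
  assumes r: "r \<in> {1..M}" and lam: "lam \<in> nonneg_family M"
  shows "(\<Sum>c=1..M. Ntilde M i b t k lam r c * \<phi> c) =
    \<phi> r * (1 + t * lam r * kt r)
      + t * lam r * (\<phi> r - q_up i b r * \<phi> (r + 1) - q_down i b r * \<phi> (r - 1))"
proof (cases "r \<in> {2..M - 1}")
  case True
  have "(\<Sum>c=1..M. Ntilde M i b t k lam r c * \<phi> c) =
      (\<Sum>c\<in>{r - 1, r, r + 1}. Ntilde M i b t k lam r c * \<phi> c)"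
    using True by (intro sum.mono_neutral_right) (auto simp: Ntilde_def)
  also have "\<dots> = \<phi> r * (1 + t * lam r * kt r)
      + t * lam r * (\<phi> r - q_up i b r * \<phi> (r + 1) - q_down i b r * \<phi> (r - 1))"
  proof -
    have "r - 1 \<noteq> r" "r - 1 \<noteq> r + 1" using True by auto
    then have "(\<Sum>c\<in>{r - 1, r, r + 1}. Ntilde M i b t k lam r c * \<phi> c) =
        Ntilde M i b t k lam r (r - 1) * \<phi> (r - 1) + Ntilde M i b t k lam r r * \<phi> r
        + Ntilde M i b t k lam r (r + 1) * \<phi> (r + 1)"
      by simp
    moreover have "Ntilde M i b t k lam r (r - 1) = - t * lam r * q_down i b r"
      "Ntilde M i b t k lam r r = 1 + t * lam r * (1 + kt r)"
      "Ntilde M i b t k lam r (r + 1) = - t * lam r * q_up i b r"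
      using True by (auto simp: Ntilde_def kt_eq)
    ultimately show ?thesis by (simp add: algebra_simps)
  qed
  finally show ?thesis .
next
  case False
  then have "lam r = 0" using lam by (auto simp: nonneg_family_def)
  moreover have "(\<Sum>c=1..M. Ntilde M i b t k lam r c * \<phi> c) =
      (\<Sum>c\<in>{r}. Ntilde M i b t k lam r c * \<phi> c)"
    using False r by (intro sum.mono_neutral_right) (auto simp: Ntilde_def)
  ultimately show ?thesis using False by (auto simp: Ntilde_def)
qed

lemma Ntilde_last: "Ntilde M i b t k lam (Suc M) c = (if c = Suc M then 1 else 0)"
  by (auto simp: Ntilde_def)

lemma col_last:
  assumes lam: "lam \<in> nonneg_family M"
  shows "col \<alpha> lam (M + 1) = 1 - \<alpha> * (1 + t * (\<Sum>j=1..M. p j * lam j * kt j))"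
proof -
  have N: "Ntilde M i b t k lam r (M + 1) = - t * lam r * kt r" if "r \<in> {1..M}" for r
    using that kt_out[of r] by (auto simp: Ntilde_def kt_eq)
  have "col \<alpha> lam (M + 1) =
    (\<Sum>r=1..M. p_hat M \<alpha> p r * Ntilde M i b t k lam r (M + 1)) + (1 - \<alpha>)"
    by (simp add: col_def p_hat_def Ntilde_last)
  also have "(\<Sum>r=1..M. p_hat M \<alpha> p r * Ntilde M i b t k lam r (M + 1)) =
      (\<Sum>r=1..M. - (\<alpha> * t) * (p r * lam r * kt r))"
    by (rule sum.cong) (use N in \<open>auto simp: p_hat_def\<close>)
  also have "\<dots> = - (\<alpha> * t) * (\<Sum>r=1..M. p r * lam r * kt r)"
    by (simp only: sum_distrib_left)
  finally show ?thesis by (simp add: algebra_simps)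
qed

text \<open>Exchanging the two sums moves the test function from the columns to the rows; row
  \<open>M + 1\<close> contributes nothing to the first \<open>M\<close> columns.\<close>

lemma col_test:
  fixes \<phi> :: "nat \<Rightarrow> real"
  assumes lam: "lam \<in> nonneg_family M"
  shows "(\<Sum>c=1..M. col \<alpha> lam c * \<phi> c) =
    \<alpha> * (\<Sum>r=1..M. p r * (\<phi> r * (1 + t * lam r * kt r)
      + t * lam r * (\<phi> r - q_up i b r * \<phi> (r + 1) - q_down i b r * \<phi> (r - 1))))"
proof -
  have "col \<alpha> lam c = (\<Sum>r=1..M. \<alpha> * p r * Ntilde M i b t k lam r c)" if "c \<in> {1..M}" for c
    using that M by (auto simp: col_def p_hat_def Ntilde_last)
  then have "(\<Sum>c=1..M. col \<alpha> lam c * \<phi> c) =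
      (\<Sum>c=1..M. \<Sum>r=1..M. \<alpha> * p r * (Ntilde M i b t k lam r c * \<phi> c))"
    by (auto simp: sum_distrib_right mult.assoc intro!: sum.cong)
  also have "\<dots> = (\<Sum>r=1..M. \<alpha> * p r * (\<Sum>c=1..M. Ntilde M i b t k lam r c * \<phi> c))"
    by (subst sum.swap) (simp add: sum_distrib_left)
  also have "\<dots> = \<alpha> * (\<Sum>r=1..M. p r * (\<phi> r * (1 + t * lam r * kt r)
      + t * lam r * (\<phi> r - q_up i b r * \<phi> (r + 1) - q_down i b r * \<phi> (r - 1))))"
    by (subst sum_distrib_left, rule sum.cong[OF refl])
      (simp only: Ntilde_row[OF _ lam] mult.assoc)
  finally show ?thesis .
qed

text \<open>The first two identities make affine functions of \<open>\<kappa>\<close> harmonic. The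
  last two say that \<open>A j\<close> is the reciprocal of the factor that the kink of a put or a
  call with strike \<open>\<kappa> j\<close> leaves in row \<open>j\<close>.\<close>

lemma q_props:
  assumes "j \<in> {2..M - 1}"
  shows "q_up i b j + q_down i b j = 1"
    and "q_up i b j * \<kappa> (j + 1) + q_down i b j * \<kappa> (j - 1) = \<kappa> j"
    and "A j * (t * p j * (q_down i b j * (\<kappa> j - \<kappa> (j - 1)))) = 1"
    and "A j * (t * p j * (q_up i b j * (\<kappa> (j + 1) - \<kappa> j))) = 1"
proof -
  have k: "\<kappa> (j - 1) < \<kappa> j" "\<kappa> j < \<kappa> (j + 1)" "0 < p j"
    using assms by (auto intro!: \<kappa>_less p_pos)
  define u where "u = \<kappa> j - \<kappa> (j - 1)"
  define v where "v = \<kappa> (j + 1) - \<kappa> j"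
  have uv: "0 < u" "0 < v" using k by (auto simp: u_def v_def)
  have up: "q_up i b j = u / (u + v)" and down: "q_down i b j = v / (u + v)"
    using q_up[OF assms] q_down[OF assms] by (auto simp: u_def v_def)
  have A: "A j = 1 / (t * p j) * ((u + v) / (v * u))"
    using assms by (simp add: A_def u_def v_def)
  have \<kappa>s: "\<kappa> (j - 1) = \<kappa> j - u" "\<kappa> (j + 1) = \<kappa> j + v" by (auto simp: u_def v_def)
  show "q_up i b j + q_down i b j = 1"
    using uv by (simp add: up down add_divide_distrib[symmetric])
  show "q_up i b j * \<kappa> (j + 1) + q_down i b j * \<kappa> (j - 1) = \<kappa> j"
  proof -
    have "q_up i b j * \<kappa> (j + 1) + q_down i b j * \<kappa> (j - 1) =
        (u * (\<kappa> j + v) + v * (\<kappa> j - u)) / (u + v)"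
      unfolding \<kappa>s up down by (simp add: add_divide_distrib)
    also have "u * (\<kappa> j + v) + v * (\<kappa> j - u) = \<kappa> j * (u + v)"
      by (simp add: algebra_simps)
    finally show ?thesis using uv by simp
  qed
  show "A j * (t * p j * (q_down i b j * (\<kappa> j - \<kappa> (j - 1)))) = 1"
    unfolding \<kappa>s A down using uv k t by simp
  show "A j * (t * p j * (q_up i b j * (\<kappa> (j + 1) - \<kappa> j))) = 1"
    unfolding \<kappa>s A up using uv k t by simp
qed

lemma affine_harmonic:
  assumes "j \<in> {2..M - 1}"
  shows "(c + d * \<kappa> j) - q_up i b j * (c + d * \<kappa> (j + 1)) - q_down i b j * (c + d * \<kappa> (j - 1)) = 0"
proof -
  have "(c + d * \<kappa> j) - q_up i b j * (c + d * \<kappa> (j + 1)) - q_down i b j * (c + d * \<kappa> (j - 1)) =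
    c * (1 - (q_up i b j + q_down i b j)) +
    d * (\<kappa> j - (q_up i b j * \<kappa> (j + 1) + q_down i b j * \<kappa> (j - 1)))"
    by (simp add: algebra_simps)
  then show ?thesis by (simp only: q_props[OF assms])  simp
qed

text \<open>Interior rows vanish by harmonicity, all others by the factor
  \<open>lam r\<close>.\<close>

lemma lam_affine:
  assumes "lam \<in> nonneg_family M"
  shows "lam r * ((c + d * \<kappa> r) - q_up i b r * (c + d * \<kappa> (r + 1))
    - q_down i b r * (c + d * \<kappa> (r - 1))) = 0"
  using affine_harmonic[of r c d] assms by (cases "r \<in> {2..M - 1}") (auto simp: nonneg_family_def)

lemma col_affine:
  assumes lam: "lam \<in> nonneg_family M"
  shows "(\<Sum>a=1..M. col \<alpha> lam a * (c + d * \<kappa> a)) =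
    \<alpha> * (\<Sum>r=1..M. (c + d * \<kappa> r) * p r * (1 + t * lam r * kt r))"
  unfolding col_test[OF lam]
  by (intro arg_cong[where f = "(*) \<alpha>"] sum.cong refl)
    (use lam_affine[OF lam] in \<open>simp add: mult.assoc mult.left_commute\<close>)

text \<open>The put is affine up to \<open>j\<close> and zero from \<open>j\<close> on, so the
  second-difference term vanishes in every row but \<open>j\<close>. There the kink leaves
  \<open>- lam j * ?Q\<close>, which \<open>A j\<close> normalizes to
  \<open>- lam j\<close>.\<close>

lemma col_put:
  assumes lam: "lam \<in> nonneg_family M" and j: "j \<in> {2..M - 1}"
  shows "A j * (\<Sum>a=1..j - 1. (\<kappa> j - \<kappa> a) * col \<alpha> lam a) =
    \<alpha> * (A j * (\<Sum>a=1..j - 1. (\<kappa> j - \<kappa> a) * p a * (1 + t * lam a * kt a)) - lam j)"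
proof -
  define \<phi> where "\<phi> a = (if a < j then \<kappa> j - \<kappa> a else 0)" for a
  let ?Q = "t * p j * (q_down i b j * (\<kappa> j - \<kappa> (j - 1)))"
  have "(\<Sum>a=1..j - 1. (\<kappa> j - \<kappa> a) * col \<alpha> lam a) = (\<Sum>a=1..M. col \<alpha> lam a * \<phi> a)"
    using j by (subst sum_put_eq[of j M]) (auto simp: \<phi>_def intro!: sum.cong)
  also have "\<dots> = \<alpha> * (\<Sum>r=1..M. (if r < j then (\<kappa> j - \<kappa> r) * p r * (1 + t * lam r * kt r) else 0)
      - (if r = j then lam j * ?Q else 0))"
    unfolding col_test[OF lam]
  proof (intro arg_cong[where f = "(*) \<alpha>"] sum.cong refl)
    fix r assume "r \<in> {1..M}"
    consider "r < j" | "r = j" | "j < r" by linarith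
    then show "p r * (\<phi> r * (1 + t * lam r * kt r)
      + t * lam r * (\<phi> r - q_up i b r * \<phi> (r + 1) - q_down i b r * \<phi> (r - 1))) =
      (if r < j then (\<kappa> j - \<kappa> r) * p r * (1 + t * lam r * kt r) else 0)
      - (if r = j then lam j * ?Q else 0)"
    proof cases
      case 1
      \<comment> \<open>For \<open>r + 1 = j\<close> the put is 0, which is also the value of the
        affine function there.\<close>
      then have "\<phi> r = \<kappa> j + (-1) * \<kappa> r" "\<phi> (r + 1) = \<kappa> j + (-1) * \<kappa> (r + 1)"
        "\<phi> (r - 1) = \<kappa> j + (-1) * \<kappa> (r - 1)"
        by (auto simp: \<phi>_def less_Suc_eq)
          (metis Suc_lessI)
      then have "lam r * (\<phi> r - q_up i b r * \<phi> (r + 1) - q_down i b r * \<phi> (r - 1)) = 0"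
        using lam_affine[OF lam, of r "\<kappa> j" "-1"] by (simp only:)
      then have "t * lam r * (\<phi> r - q_up i b r * \<phi> (r + 1) - q_down i b r * \<phi> (r - 1)) = 0"
        by simp
      then show ?thesis using 1 by (simp only:) (simp add: \<phi>_def)
    next
      case 2
      then show ?thesis using j by (auto simp: \<phi>_def)
    next
      case 3
      then show ?thesis by (auto simp: \<phi>_def)
    qed
  qed
  also have "\<dots> = \<alpha> * ((\<Sum>a=1..j - 1. (\<kappa> j - \<kappa> a) * p a * (1 + t * lam a * kt a)) - lam j * ?Q)"
  proof -
    have "j \<le> M" "j \<in> {1..M}" using j by auto
    then show ?thesis
      using sum_put_eq[of j M "\<lambda>a. (\<kappa> j - \<kappa> a) * p a * (1 + t * lam a * kt a)"]
      by (simp add: sum_subtractf)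
  qed
  finally have "A j * (\<Sum>a=1..j - 1. (\<kappa> j - \<kappa> a) * col \<alpha> lam a) =
    \<alpha> * (A j * (\<Sum>a=1..j - 1. (\<kappa> j - \<kappa> a) * p a * (1 + t * lam a * kt a)) - lam j * (A j * ?Q))"
    by (simp only: right_diff_distrib mult.left_commute)
  then show ?thesis unfolding q_props(3)[OF j] by simp
qed

text \<open>Mirror image of the put: the call is zero up to \<open>j\<close> and affine from
  \<open>j\<close> on, and in row \<open>j\<close> the upward neighbour remains.\<close>

lemma col_call:
  assumes lam: "lam \<in> nonneg_family M" and j: "j \<in> {2..M - 1}"
  shows "A j * (\<Sum>a=j + 1..M. (\<kappa> a - \<kappa> j) * col \<alpha> lam a) =
    \<alpha> * (A j * (\<Sum>a=j + 1..M. (\<kappa> a - \<kappa> j) * p a * (1 + t * lam a * kt a)) - lam j)"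
proof -
  define \<phi> where "\<phi> a = (if j < a then \<kappa> a - \<kappa> j else 0)" for a
  let ?Q = "t * p j * (q_up i b j * (\<kappa> (j + 1) - \<kappa> j))"
  have "(\<Sum>a=j + 1..M. (\<kappa> a - \<kappa> j) * col \<alpha> lam a) = (\<Sum>a=1..M. col \<alpha> lam a * \<phi> a)"
    by (subst sum_call_eq) (auto simp: \<phi>_def intro!: sum.cong)
  also have "\<dots> = \<alpha> * (\<Sum>r=1..M. (if j < r then (\<kappa> r - \<kappa> j) * p r * (1 + t * lam r * kt r) else 0)
      - (if r = j then lam j * ?Q else 0))"
    unfolding col_test[OF lam]
  proof (intro arg_cong[where f = "(*) \<alpha>"] sum.cong refl)
    fix r assume "r \<in> {1..M}"
    consider "r < j" | "r = j" | "j < r" by linarith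
    then show "p r * (\<phi> r * (1 + t * lam r * kt r)
      + t * lam r * (\<phi> r - q_up i b r * \<phi> (r + 1) - q_down i b r * \<phi> (r - 1))) =
      (if j < r then (\<kappa> r - \<kappa> j) * p r * (1 + t * lam r * kt r) else 0)
      - (if r = j then lam j * ?Q else 0)"
    proof cases
      case 1
      then show ?thesis by (auto simp: \<phi>_def)
    next
      case 2
      then show ?thesis using j by (auto simp: \<phi>_def)
    next
      case 3
      then have "\<phi> r = - \<kappa> j + 1 * \<kappa> r" "\<phi> (r + 1) = - \<kappa> j + 1 * \<kappa> (r + 1)"
        "\<phi> (r - 1) = - \<kappa> j + 1 * \<kappa> (r - 1)"
        by (auto simp: \<phi>_def)
          (metis Suc_pred less_SucE gr_implies_not0 neq0_conv)
      then have "lam r * (\<phi> r - q_up i b r * \<phi> (r + 1) - q_down i b r * \<phi> (r - 1)) = 0"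
        using lam_affine[OF lam, of r "- \<kappa> j" "1"] by (simp only:)
      then have "t * lam r * (\<phi> r - q_up i b r * \<phi> (r + 1) - q_down i b r * \<phi> (r - 1)) = 0"
        by simp
      then show ?thesis using 3 by (simp only:) (simp add: \<phi>_def)
    qed
  qed
  also have "\<dots> = \<alpha> * ((\<Sum>a=j + 1..M. (\<kappa> a - \<kappa> j) * p a * (1 + t * lam a * kt a)) - lam j * ?Q)"
    using j by (subst sum_call_eq) (auto simp: sum_subtractf)
  finally have "A j * (\<Sum>a=j + 1..M. (\<kappa> a - \<kappa> j) * col \<alpha> lam a) =
    \<alpha> * (A j * (\<Sum>a=j + 1..M. (\<kappa> a - \<kappa> j) * p a * (1 + t * lam a * kt a)) - lam j * (A j * ?Q))"
    by (simp only: right_diff_distrib mult.left_commute)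
  then show ?thesis unfolding q_props(4)[OF j] by simp
qed

text \<open>\<open>target l x\<close> carries the linear interpolation weights of \<open>x\<close>
  between the grid points \<open>l - 1\<close> and \<open>l\<close>, and these reproduce affine
  functions.\<close>

lemma target_affine:
  assumes "l \<in> {2..M}"
  shows "(\<Sum>a=1..M. target l x a * (c + d * \<kappa> a)) = c + d * x"
proof -
  have "\<kappa> (l - 1) < \<kappa> l" using assms by (intro \<kappa>_less) auto
  have "(\<Sum>a=1..M. target l x a * (c + d * \<kappa> a)) = (\<Sum>a\<in>{l - 1, l}. target l x a * (c + d * \<kappa> a))"
    using assms by (intro sum.mono_neutral_right) (auto simp: target_def)
  also have "\<dots> = (\<kappa> l - x) / (\<kappa> l - \<kappa> (l - 1)) * (c + d * \<kappa> (l - 1))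
      + (x - \<kappa> (l - 1)) / (\<kappa> l - \<kappa> (l - 1)) * (c + d * \<kappa> l)"
    using assms by (auto simp: target_def)
  also have "\<dots> = ((\<kappa> l - x) * (c + d * \<kappa> (l - 1)) + (x - \<kappa> (l - 1)) * (c + d * \<kappa> l))
      / (\<kappa> l - \<kappa> (l - 1))"
    by (simp add: add_divide_distrib)
  also have "(\<kappa> l - x) * (c + d * \<kappa> (l - 1)) + (x - \<kappa> (l - 1)) * (c + d * \<kappa> l) =
      (c + d * x) * (\<kappa> l - \<kappa> (l - 1))"
    by (simp add: algebra_simps)
  also have "\<dots> / (\<kappa> l - \<kappa> (l - 1)) = c + d * x"
    using \<open>\<kappa> (l - 1) < \<kappa> l\<close> by simp
  finally show ?thesis .
qed

text \<open>The sum stops before \<open>j \<le> l - 1\<close>, hence before the two indices that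
  carry the target.\<close>

lemma target_put:
  assumes "j \<le> l - 1"
  shows "(\<Sum>a=1..j - 1. (\<kappa> j - \<kappa> a) * target l x a) = 0"
  using assms by (intro sum.neutral) (auto simp: target_def)

lemma target_call:
  assumes "l \<le> j"
  shows "(\<Sum>a=j + 1..M. (\<kappa> a - \<kappa> j) * target l x a) = 0"
  using assms by (intro sum.neutral) (auto simp: target_def)

lemma weight_sum:
  "(\<Sum>j=1..M. p j * (1 + t * lam j * kt j)) = 1 + t * (\<Sum>j=1..M. p j * lam j * kt j)"
  using p_sum by (simp add: distrib_left sum.distrib sum_distrib_left mult_ac)

lemma nonneg_familyD: "lam \<in> nonneg_family M \<Longrightarrow> 0 \<le> lam j"
  by (cases "j \<in> {2..M - 1}") (auto simp: nonneg_family_def)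

lemma lam_weight_nonneg:
  assumes lam: "lam \<in> nonneg_family M"
  shows "0 \<le> t * (\<Sum>j=1..M. p j * lam j * kt j)"
proof (rule mult_nonneg_nonneg[OF _ sum_nonneg])
  fix j assume "j \<in> {1..M}"
  then show "0 \<le> p j * lam j * kt j"
    using p_pos[of j] nonneg_familyD[OF lam, of j] kt_nonneg[of j] by simp
qed (use t in auto)

lemma A_nonzero: "j \<in> {2..M - 1} \<Longrightarrow> A j \<noteq> 0"
  using q_props(3)[of j] by auto

text \<open>
  For the converse, put-call parity turns the calls beyond \<open>l\<close> into puts, and all puts together
  form a triangular system.
\<close>

lemma is_solution_iff:
  "is_solution M i b t k p \<kappa> \<alpha> l x lam \<longleftrightarrow>
    G_system M \<kappa> kt t p lam l \<and> \<alpha> = 1 / (1 + t * (\<Sum>j=1..M. p j * lam j * kt j)) \<and>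
    x = weighted_mean M \<kappa> kt t p lam"
  (is "?sol \<longleftrightarrow> ?G \<and> \<alpha> = 1 / ?W \<and> x = ?m")
proof
  assume sol: ?sol
  then have \<alpha>: "0 < \<alpha>" and l: "l \<in> {2..M}" and x: "\<kappa> (l - 1) < x" "x \<le> \<kappa> l"
    and lam: "lam \<in> nonneg_family M"
    by (auto simp: is_solution_def)
  have col: "col \<alpha> lam j = target l x j" if "j \<in> {1..M + 1}" for j
    using sol that by (auto simp: is_solution_def col_def target_def)
  have W: "1 \<le> ?W" using lam_weight_nonneg[OF lam] by simp
  \<comment> \<open>Since \<open>l \<le> M\<close>, the target vanishes in the last column; this
    determines \<open>\<alpha>\<close>.\<close>
  have "col \<alpha> lam (M + 1) = 0"
    using col[of "M + 1"] l by (auto simp: target_def)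
  then have "\<alpha> * ?W = 1"
    using col_last[OF lam, of \<alpha>] by simp
  then have \<alpha>_eq: "\<alpha> = 1 / ?W"
    using W by (simp add: eq_divide_eq)
  \<comment> \<open>The first moment determines \<open>x\<close>; the coefficients 0 and 1 write
    \<open>\<kappa>\<close> as an instance of the affine test.\<close>
  have "(\<Sum>a=1..M. col \<alpha> lam a * (0 + 1 * \<kappa> a)) = (\<Sum>a=1..M. target l x a * (0 + 1 * \<kappa> a))"
    by (rule sum.cong) (auto simp: col)
  then have "\<alpha> * (\<Sum>r=1..M. \<kappa> r * p r * (1 + t * lam r * kt r)) = x"
    unfolding target_affine[OF l] col_affine[OF lam] by simp
  then have x_eq: "x = ?m"
    unfolding weighted_mean_def weight_sum \<alpha>_eq by simp
  \<comment> \<open>Puts left of \<open>l\<close> and calls from \<open>l\<close> on do not see the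
    target, so cancelling \<open>\<alpha> > 0\<close> leaves the equation for
    \<open>lam j\<close>.\<close>
  have "lam j = A j * (if j \<le> l - 1 then \<Sum>a=1..j - 1. (\<kappa> j - \<kappa> a) * p a * (1 + t * lam a * kt a)
           else \<Sum>a=j + 1..M. (\<kappa> a - \<kappa> j) * p a * (1 + t * lam a * kt a))"
    if j: "j \<in> {2..M - 1}" for j
  proof (cases "j \<le> l - 1")
    case True
    have "(\<Sum>a=1..j - 1. (\<kappa> j - \<kappa> a) * col \<alpha> lam a) = (\<Sum>a=1..j - 1. (\<kappa> j - \<kappa> a) * target l x a)"
      by (rule sum.cong) (use j in \<open>auto simp: col\<close>)
    then show ?thesis
      using col_put[OF lam j, of \<alpha>] target_put[OF True, of x] True \<alpha> by simp
  next
    case False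
    have "(\<Sum>a=j + 1..M. (\<kappa> a - \<kappa> j) * col \<alpha> lam a) = (\<Sum>a=j + 1..M. (\<kappa> a - \<kappa> j) * target l x a)"
      by (rule sum.cong) (use j in \<open>auto simp: col\<close>)
    then show ?thesis
      using col_call[OF lam j, of \<alpha>] target_call[of l j x] False \<alpha> by simp
  qed
  then have ?G
    using lam l x x_eq by (auto simp: G_system_def A_def)
  then show "?G \<and> \<alpha> = 1 / ?W \<and> x = ?m" using \<alpha>_eq x_eq by simp
next
  assume asm: "?G \<and> \<alpha> = 1 / ?W \<and> x = ?m"
  then have l: "l \<in> {2..M}" and x: "\<kappa> (l - 1) < x" "x \<le> \<kappa> l"
    and lam: "lam \<in> nonneg_family M" and \<alpha>_eq: "\<alpha> = 1 / ?W"
    by (auto simp: G_system_def)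
  have W: "1 \<le> ?W" using lam_weight_nonneg[OF lam] by simp
  then have \<alpha>: "0 < \<alpha>" "\<alpha> \<le> 1" using \<alpha>_eq by auto
  have lam_eq: "lam j = A j *
      (if j \<le> l - 1 then \<Sum>a=1..j - 1. (\<kappa> j - \<kappa> a) * p a * (1 + t * lam a * kt a)
       else \<Sum>a=j + 1..M. (\<kappa> a - \<kappa> j) * p a * (1 + t * lam a * kt a))"
    if j: "j \<in> {2..M - 1}" for j
    using asm j by (auto simp: G_system_def A_def)
  \<comment> \<open>The residual of the matrix equation, to be annihilated by the affine tests and
    all puts.\<close>
  define v where "v j = col \<alpha> lam j - target l x j" for j
  have affine: "(\<Sum>a=1..M. v a * (c + d * \<kappa> a)) = 0" for c d
  proof -
    let ?K = "\<Sum>r=1..M. \<kappa> r * p r * (1 + t * lam r * kt r)"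
    have split: "(\<Sum>r=1..M. (c + d * \<kappa> r) * p r * (1 + t * lam r * kt r)) = c * ?W + d * ?K"
      unfolding weight_sum[symmetric]
      by (simp add: distrib_right sum.distrib sum_distrib_left mult.assoc)
    have "x = ?K / ?W"
      using asm unfolding weighted_mean_def weight_sum by blast
    then have norm: "\<alpha> * ?K = x" "\<alpha> * ?W = 1" using \<alpha>_eq W by auto
    have "\<alpha> * (c * ?W + d * ?K) = c * (\<alpha> * ?W) + d * (\<alpha> * ?K)"
      by (simp only: distrib_left[of \<alpha>] mult.left_commute[of \<alpha>])
    also have "\<dots> = c + d * x" unfolding norm by simp
    finally have "\<alpha> * (c * ?W + d * ?K) = c + d * x" .
    then have "\<alpha> * (\<Sum>r=1..M. (c + d * \<kappa> r) * p r * (1 + t * lam r * kt r)) = c + d * x"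
      unfolding split .
    then show ?thesis
      unfolding v_def left_diff_distrib sum_subtractf col_affine[OF lam] target_affine[OF l] by simp
  qed
  have put: "(\<Sum>a=1..j - 1. (\<kappa> j - \<kappa> a) * v a) = 0" if j: "2 \<le> j" "j \<le> M" for j
  proof -
    have parity: "(\<Sum>a=1..j - 1. (\<kappa> j - \<kappa> a) * v a) = (\<Sum>a=j + 1..M. (\<kappa> a - \<kappa> j) * v a)"
      using affine[of "- \<kappa> j" 1] sum_centered_split[of j v] j by (simp add: mult.commute)
    consider "j = M" | "j \<in> {2..M - 1}" "j \<le> l - 1" | "j \<in> {2..M - 1}" "\<not> j \<le> l - 1"
      using j by fastforce
    then show ?thesis
    proof cases
      case 1
      \<comment> \<open>For \<open>j = M\<close> the call sum is empty.\<close>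
      then show ?thesis using parity by simp
    next
      case 2
      then have "A j * (\<Sum>a=1..j - 1. (\<kappa> j - \<kappa> a) * col \<alpha> lam a) = 0"
        using col_put[OF lam 2(1), of \<alpha>] lam_eq[OF 2(1)] by simp
      then have "(\<Sum>a=1..j - 1. (\<kappa> j - \<kappa> a) * col \<alpha> lam a) = 0"
        using A_nonzero[OF 2(1)] by simp
      then show ?thesis
        using target_put[OF 2(2), of x] by (simp add: v_def right_diff_distrib sum_subtractf)
    next
      case 3
      then have "A j * (\<Sum>a=j + 1..M. (\<kappa> a - \<kappa> j) * col \<alpha> lam a) = 0"
        using col_call[OF lam 3(1), of \<alpha>] lam_eq[OF 3(1)] by simp
      then have "(\<Sum>a=j + 1..M. (\<kappa> a - \<kappa> j) * col \<alpha> lam a) = 0"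
        using A_nonzero[OF 3(1)] by simp
      then show ?thesis
        unfolding parity
        using target_call[of l j x] 3 by (simp add: v_def right_diff_distrib sum_subtractf)
    qed
  qed
  have "v j = 0" if "j \<in> {1..M}" for j
    by (rule family_eq_zero_of_puts[OF \<kappa> put _ that]) (use affine[of 1 0] in auto)
  moreover have "v (M + 1) = 0"
    using col_last[OF lam, of \<alpha>] \<alpha>_eq W l by (auto simp: v_def target_def)
  ultimately have "v j = 0" if "j \<in> {1..M + 1}" for j
    using that by (cases "j = M + 1") auto
  then have "col \<alpha> lam j = target l x j" if "j \<in> {1..M + 1}" for j
    using that by (auto simp: v_def)
  then show ?sol
    using \<alpha> l x lam by (auto simp: is_solution_def col_def target_def)
qed

end

section \<open>The \<open>\<kappa>\<close>-coordinates\<close>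

text \<open>Keeps the sum in the denominator of \<open>eps\<close> within \<open>{1..M - 1}\<close>,
  where its terms are positive. Both index sets are nonempty because the whole mass is
  \<open>1 \<ge> \<theta>\<close>.\<close>

lemma e_minus_e_plus_bounds:
  assumes "1 \<le> M" "p \<in> open_simplex M" "\<theta> \<le> 1"
  shows "1 \<le> e_minus M p \<theta>" "e_plus M p \<theta> \<le> M"
proof -
  have s: "(\<Sum>a=1..M. p a) = 1" using assms by (simp add: open_simplex_def)
  have "M \<in> {j \<in> {1..M}. (\<Sum>a=1..j. p a) \<ge> \<theta>}" using s assms by auto
  then have "e_minus M p \<theta> \<in> {j \<in> {1..M}. (\<Sum>a=1..j. p a) \<ge> \<theta>}"
    unfolding e_minus_def by (intro Inf_nat_def1) auto
  then show "1 \<le> e_minus M p \<theta>" by simp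
  have "1 \<in> {j \<in> {1..M}. (\<Sum>a=j..M. p a) \<ge> \<theta>}" using s assms by auto
  then show "e_plus M p \<theta> \<le> M"
    unfolding e_plus_def by (intro cSup_least) auto
qed

lemma gap_pos:
  assumes "strict_mono_on {1..M} i" "2 \<le> j" "j \<le> M"
  shows "0 < gap i j"
proof -
  have "j - 1 \<in> {1..M}" "j \<in> {1..M}" "j - 1 < j" using assms(2,3) by auto
  then show ?thesis using strict_mono_onD[OF assms(1)] by (simp add: gap_def)
qed

lemma drift_bounds:
  assumes "strict_mono_on {1..M} i"
    and "\<forall>j\<in>{2..M - 1}. - (1 / (i (j + 1) - i j)) < b j \<and> b j < 1 / (i j - i (j - 1))"
    and j: "j \<in> {2..M - 1}"
  shows "0 < 1 - gap i j * b j" "0 < 1 + gap i (j + 1) * b j"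
proof -
  have g: "0 < gap i j" "0 < gap i (j + 1)"
    using j by (auto intro!: gap_pos[OF assms(1)])
  have "- (1 / gap i (j + 1)) < b j" "b j < 1 / gap i j"
    using assms(2) j by (auto simp: gap_def)
  then show "0 < 1 - gap i j * b j" "0 < 1 + gap i (j + 1) * b j"
    using g by (auto simp: field_simps)
qed

lemma Pi_prod_pos:
  assumes "strict_mono_on {1..M} i"
    and "\<forall>j\<in>{2..M - 1}. - (1 / (i (j + 1) - i j)) < b j \<and> b j < 1 / (i j - i (j - 1))"
    and "j \<le> M - 1"
  shows "0 < Pi_prod i b j"
  unfolding Pi_prod_def
proof (rule prod_pos)
  fix n assume "n \<in> {2..j}"
  then have "n \<in> {2..M - 1}" using assms(3) by auto
  from drift_bounds[OF assms(1,2) this]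
  show "0 < (1 - gap i n * b n) / (1 + gap i (n + 1) * b n)" by simp
qed

text \<open>The normalization of \<open>eps\<close> is one factor common to all \<open>j\<close>. It
  cancels in the ratios of increments that give \<open>q\<close>, so only its sign has to be
  kept.\<close>

lemma eps_scaled:
  assumes "1 \<le> M" "strict_mono_on {1..M} i" "p \<in> open_simplex M"
    and "\<forall>j\<in>{2..M - 1}. - (1 / (i (j + 1) - i j)) < b j \<and> b j < 1 / (i j - i (j - 1))"
    and "\<theta> \<le> 1" "e_minus M p \<theta> < e_plus M p \<theta>"
  obtains C where "0 < C" "\<And>j. eps M i b p \<theta> j = C * (gap i j * Pi_prod i b (j - 1))"
proof -
  let ?S = "\<Sum>a=e_minus M p \<theta>..e_plus M p \<theta> - 1. gap i (a + 1) * Pi_prod i b a"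
  note e = e_minus_e_plus_bounds[OF assms(1,3,5)]
  have "0 < ?S"
  proof (rule sum_pos)
    fix a assume "a \<in> {e_minus M p \<theta>..e_plus M p \<theta> - 1}"
    then have "1 \<le> a" "a \<le> M - 1" using e by auto
    then show "0 < gap i (a + 1) * Pi_prod i b a"
      using gap_pos[OF assms(2), of "a + 1"] Pi_prod_pos[OF assms(2,4)] by simp
  qed (use assms(6) in auto)
  then show ?thesis
    by (intro that[of "max (i (e_plus M p \<theta>) - i (e_minus M p \<theta>)) 1 / ?S"])
      (auto simp: eps_def)
qed

text \<open>Here \<open>x\<close> and \<open>y\<close> are consecutive increments of
  \<open>\<kappa>\<close>. With the common factor \<open>D\<close> they are
  \<open>D * (g * (1 + h * \<beta>))\<close> and \<open>D * (h * (1 - g * \<beta>))\<close>, and the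
  mixed terms cancel in \<open>x + y = D * (g + h)\<close>.\<close>

lemma q_eq_ratio:
  fixes g h \<beta> C P :: real
  assumes "0 < g" "0 < h" "0 < 1 - g * \<beta>" "0 < 1 + h * \<beta>" "0 < C" "0 < P"
  defines "x \<equiv> C * (g * P)" and "y \<equiv> C * (h * (P * ((1 - g * \<beta>) / (1 + h * \<beta>))))"
  shows "g / (g + h) * (1 + h * \<beta>) = x / (x + y)" "h / (g + h) * (1 - g * \<beta>) = y / (x + y)"
proof -
  define u where "u = 1 + h * \<beta>"
  define D where "D = C * P / u"
  have u: "0 < u" using assms by (simp add: u_def)
  have D: "0 < D" using assms u by (simp add: D_def)
  have x: "x = D * (g * u)" using u by (simp add: x_def D_def)
  have y: "y = D * (h * (1 - g * \<beta>))" by (simp add: y_def D_def u_def)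
  have xy: "x + y = D * (g + h)" unfolding x y by (simp add: u_def algebra_simps)
  show "g / (g + h) * (1 + h * \<beta>) = x / (x + y)"
    unfolding xy unfolding x u_def[symmetric] using D by simp
  show "h / (g + h) * (1 - g * \<beta>) = y / (x + y)"
    unfolding xy unfolding y using D by simp
qed

lemma Pi_prod_step:
  assumes "2 \<le> j"
  shows "Pi_prod i b j = Pi_prod i b (j - 1) * ((1 - gap i j * b j) / (1 + gap i (j + 1) * b j))"
proof -
  have "{2..j} = insert j {2..j - 1}" using assms by auto
  then show ?thesis using assms by (simp add: Pi_prod_def mult.commute)
qed

theorem lemma7p4:
  fixes M e :: nat and t \<theta> :: real and i p b k \<kappa> kt :: "nat \<Rightarrow> real"
  assumes "3 \<le> M" and "0 < t"
    and "strict_mono_on {1..M} i"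
    and "p \<in> open_simplex M"
    and "\<forall>j\<in>{2..M - 1}. - (1 / (i (j + 1) - i j)) < b j \<and> b j < 1 / (i j - i (j - 1))"
    and "\<forall>j\<in>{2..M - 1}. 0 \<le> k j"
    and "0 < \<theta>" and "\<theta> < 1 / 2" and "e_minus M p \<theta> < e_plus M p \<theta>"
    and "e \<in> {1..M}" and "(\<Sum>a=1..e. p a) \<ge> 1 / 2" and "(\<Sum>a=e..M. p a) \<ge> 1 / 2"
    and "\<kappa> = kappa M i b p \<theta> e" and "kt = ktilde M i k"
  shows "(\<exists>!(\<alpha>, l, x0, lam). is_solution M i b t k p \<kappa> \<alpha> l x0 lam) \<and>
    (\<forall>\<alpha> l x0 lam. is_solution M i b t k p \<kappa> \<alpha> l x0 lam \<longrightarrow>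
       (\<forall>j\<in>{2..M - 1}. lam j = calG M \<kappa> kt t p j) \<and>
       \<alpha> = 1 / (1 + t * (\<Sum>j=1..M. p j * lam j * kt j)) \<and>
       x0 = (\<Sum>j=1..M. \<kappa> j * p j * (1 + t * calG M \<kappa> kt t p j * kt j)) /
            (\<Sum>j=1..M. p j * (1 + t * calG M \<kappa> kt t p j * kt j)))"
proof -
  note i = assms(3) and b = assms(5)
  have "1 \<le> M" "\<theta> \<le> 1" using assms(1,8) by auto
  then obtain C where C: "0 < C" and eps: "\<And>j. eps M i b p \<theta> j = C * (gap i j * Pi_prod i b (j - 1))"
    using eps_scaled[OF _ assms(3,4,5) _ assms(9)] by blast
  have step: "\<kappa> j - \<kappa> (j - 1) = C * (gap i j * Pi_prod i b (j - 1))" if "2 \<le> j" for j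
    using kappa_step[OF that, of M i b p \<theta> e] eps assms(13) by simp
  have mono: "strict_mono_on {1..M} \<kappa>"
  proof (rule strict_mono_on_of_step)
    fix j assume j: "2 \<le> j" "j \<le> M"
    then have "0 < C * (gap i j * Pi_prod i b (j - 1))"
      using C gap_pos[OF i j] Pi_prod_pos[OF i b] by simp
    then show "\<kappa> (j - 1) < \<kappa> j" using step[OF j(1)] by simp
  qed
  have kt_nonneg: "0 \<le> kt j" for j
  proof (cases "j \<in> {2..M - 1}")
    case True
    then have "0 < gap i j" "0 < gap i (j + 1)" by (auto intro!: gap_pos[OF i])
    then show ?thesis using True assms(6,14) by (simp add: ktilde_def gap_def)
  qed (auto simp: assms(14) ktilde_def)
  have q: "q_up i b j = (\<kappa> j - \<kappa> (j - 1)) / (\<kappa> (j + 1) - \<kappa> (j - 1))"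
    "q_down i b j = (\<kappa> (j + 1) - \<kappa> j) / (\<kappa> (j + 1) - \<kappa> (j - 1))" if j: "j \<in> {2..M - 1}" for j
  proof -
    have g: "0 < gap i j" "0 < gap i (j + 1)" using j by (auto intro!: gap_pos[OF i])
    have P: "0 < Pi_prod i b (j - 1)" using j by (intro Pi_prod_pos[OF i b]) auto
    note ratio = q_eq_ratio[OF g drift_bounds[OF i b j] C P]
    \<comment> \<open>\<open>Pi_prod_step\<close> absorbs the extra quotient into the product at
      \<open>j\<close>, which gives the next increment of \<open>\<kappa>\<close>.\<close>
    have s: "C * (gap i (j + 1) * (Pi_prod i b (j - 1) *
        ((1 - gap i j * b j) / (1 + gap i (j + 1) * b j)))) = \<kappa> (j + 1) - \<kappa> j"
      "C * (gap i j * Pi_prod i b (j - 1)) = \<kappa> j - \<kappa> (j - 1)"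
      using step[of j] step[of "j + 1"] Pi_prod_step[of j i b] j by auto
    have gs: "gap i j + gap i (j + 1) = i (j + 1) - i (j - 1)" "gap i (j + 1) = i (j + 1) - i j"
      "gap i j = i j - i (j - 1)"
      by (auto simp: gap_def)
    \<comment> \<open>The sum of the two gaps is rewritten before the single gaps, so that it
      telescopes to the denominator of \<open>q_up\<close>.\<close>
    show "q_up i b j = (\<kappa> j - \<kappa> (j - 1)) / (\<kappa> (j + 1) - \<kappa> (j - 1))"
      using ratio(1) unfolding s unfolding q_up_def gs(1) unfolding gs by simp
    show "q_down i b j = (\<kappa> (j + 1) - \<kappa> j) / (\<kappa> (j + 1) - \<kappa> (j - 1))"
      using ratio(2) unfolding s unfolding q_down_def gs(1) unfolding gs by simp
  qed
  have kt_out: "kt j = 0" if "j \<notin> {2..M - 1}" for j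
    using that unfolding assms(14) ktilde_def by (rule if_not_P)
  have p_pos: "0 < p j" if "j \<in> {1..M}" for j
    using that assms(4) by (auto simp: open_simplex_def)
  have p_sum: "(\<Sum>j=1..M. p j) = 1"
    using assms(4) by (simp add: open_simplex_def)
  interpret tridiagonal_chain M t p \<kappa> kt i b k
    by unfold_locales (fact assms mono kt_nonneg q kt_out p_pos p_sum)+
  obtain G l where Gl: "G_system M \<kappa> kt t p G l"
    and uniq: "\<And>G' l'. G_system M \<kappa> kt t p G' l' \<Longrightarrow> G' = G \<and> l' = l"
    using G_system_unique by blast
  \<comment> \<open>Uniqueness of the pair \<open>G\<close>, \<open>l\<close> makes the definite
    description in \<open>calG\<close> denote \<open>G\<close>.\<close>
  have G: "calG M \<kappa> kt t p = G"
    unfolding calG_def using Gl uniq by (intro the_equality) blast+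
  show ?thesis
  proof (intro conjI)
    \<comment> \<open>By \<open>is_solution_iff\<close>, \<open>\<alpha>\<close> and
      \<open>x0\<close> are functions of \<open>lam\<close>, so the unique \<open>G\<close> and
      \<open>l\<close> fix the whole tuple.\<close>
    let ?\<alpha> = "1 / (1 + t * (\<Sum>j=1..M. p j * G j * kt j))"
    show "\<exists>!(\<alpha>, l, x0, lam). is_solution M i b t k p \<kappa> \<alpha> l x0 lam"
    proof (rule ex1I[of _ "(?\<alpha>, l, weighted_mean M \<kappa> kt t p G, G)"])
      show "case (?\<alpha>, l, weighted_mean M \<kappa> kt t p G, G) of (\<alpha>, l, x0, lam) \<Rightarrow>
          is_solution M i b t k p \<kappa> \<alpha> l x0 lam"
        using Gl by (simp add: is_solution_iff)
    next
      fix s assume "case s of (\<alpha>, l, x0, lam) \<Rightarrow> is_solution M i b t k p \<kappa> \<alpha> l x0 lam"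
      moreover obtain \<alpha> l' x0 lam where s: "s = (\<alpha>, l', x0, lam)"
        by (cases s) auto
      ultimately have sol: "is_solution M i b t k p \<kappa> \<alpha> l' x0 lam" by simp
      then have "lam = G \<and> l' = l" using uniq unfolding is_solution_iff by blast
      then show "s = (?\<alpha>, l, weighted_mean M \<kappa> kt t p G, G)"
        using sol unfolding s is_solution_iff by simp
    qed
    show "\<forall>\<alpha> l x0 lam. is_solution M i b t k p \<kappa> \<alpha> l x0 lam \<longrightarrow>
       (\<forall>j\<in>{2..M - 1}. lam j = calG M \<kappa> kt t p j) \<and>
       \<alpha> = 1 / (1 + t * (\<Sum>j=1..M. p j * lam j * kt j)) \<and>
       x0 = (\<Sum>j=1..M. \<kappa> j * p j * (1 + t * calG M \<kappa> kt t p j * kt j)) /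
            (\<Sum>j=1..M. p j * (1 + t * calG M \<kappa> kt t p j * kt j))"
      unfolding G is_solution_iff weighted_mean_def[symmetric] using uniq by blast
  qed
qed

end
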